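(* For all integers $n\ge 0$, \[ E_n(t,q) = \frac{1}{(1-q)^{2n}} \sum_{k=0}^n \left( \binom{2n}{n-k} - \binom{2n}{n-k-1} \right) t^k q^{k(k+1)}\, T_k(t^{-1}, q^{-1}),\] where $\{T_k(t,q)\}_{k\ge0}$ is the family of polynomials in $t$ and $q$ determined uniquely by $T_0(t,q)=1$ and, for $k\geq1$, \[ T_k(t,q) = T_{k-1}(t,q) + (1+t)(-q)^{k^2} + (1-t^2) \sum_{i=1}^{k-1} (-q)^{k^2-i^2}\, T_{i-1}(t,q). \]
   Context: Here $t,q$ are indeterminates, $[n]_q=(1-q^n)/(1-q)$ and $[n]_{t,q}=(1-tq^n)/(1-q)$. The $(t,q)$-Euler numbers $E_n(t,q)$, $n\ge 0$, are defined by the continued fraction expansion (as a formal power series in $x$) \[ \sum_{n\geq0} E_{n}(t,q) x^n = \cfrac{1}{1- \cfrac{[1]_q[1]_{t,q}\, x}{1- \cfrac{[2]_q[2]_{t,q}\, x}{1-\cdots}}}, \] where the $m$-th partial coefficient is $[m]_q[m]_{t,q}$. Binomial coefficients $\binom{a}{b}$ with $b<0$ are $0$. *)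

theory Defs
  imports "HOL-Computational_Algebra.Computational_Algebra"
begin

text \<open>
  The field Q(t,q) is the fraction field of Z[q][t]: in \<^typ>\<open>int poly poly\<close> the inner variable
  is q and the outer variable is t.
\<close>

type_synonym ratfun_tq = "int poly poly fract"

definition tpol :: "int poly poly" where "tpol = [:0, 1:]"
definition qpol :: "int poly poly" where "qpol = [:[:0, 1:]:]"

definition t_ind :: ratfun_tq where "t_ind = Fraction_Field.Fract tpol 1"
definition q_ind :: ratfun_tq where "q_ind = Fraction_Field.Fract qpol 1"

text \<open>Substitution of a for t (the outer variable) and b for q (the inner one).\<close>

definition subst_tq :: "int poly poly \<Rightarrow> 'a::comm_ring_1 \<Rightarrow> 'a \<Rightarrow> 'a" where
  "subst_tq P a b = poly (map_poly (\<lambda>c. poly (map_poly of_int c) b) P) a"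

definition q_int :: "'a::field \<Rightarrow> nat \<Rightarrow> 'a" where
  "q_int q n = (1 - q ^ n) / (1 - q)"

definition tq_int :: "'a::field \<Rightarrow> 'a \<Rightarrow> nat \<Rightarrow> 'a" where
  "tq_int t q n = (1 - t * q ^ n) / (1 - q)"

text \<open>
  \<open>sfrac_conv a d m\<close> is 1/(1 - a(m) x/(1 - a(m+1) x/(... /(1 - a(m+d-1) x)))).
\<close>

primrec sfrac_conv :: "(nat \<Rightarrow> 'a::field) \<Rightarrow> nat \<Rightarrow> nat \<Rightarrow> 'a fps" where
  "sfrac_conv a 0 m = 1"
| "sfrac_conv a (Suc d) m = inverse (1 - fps_const (a m) * fps_X * sfrac_conv a d (Suc m))"

text \<open>
  The infinite continued fraction, with first partial coefficient a(1), is the limit of its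
  convergents in the X-adic topology; the limit always exists (see \<open>sfrac_conv_tendsto\<close>).
\<close>

definition sfrac :: "(nat \<Rightarrow> 'a::field) \<Rightarrow> 'a fps" where
  "sfrac a = lim (\<lambda>d. sfrac_conv a d 1)"

lemma fps_inverse_nth_cong:
  fixes f g :: "'a::field fps"
  assumes "\<And>i. i \<le> n \<Longrightarrow> fps_nth f i = fps_nth g i"
  shows "fps_nth (inverse f) n = fps_nth (inverse g) n"
  using assms
proof (induction n rule: less_induct)
  case (less n)
  have "fps_nth (inverse f) i = fps_nth (inverse g) i" if "i < n" for i
    using less that by auto
  then show ?case using less.prems
    by (cases n) (auto simp: fps_inverse_def intro!: sum.cong)
qed

lemma sfrac_conv_stable: "n \<le> d \<Longrightarrow> fps_nth (sfrac_conv a d m) n = fps_nth (sfrac_conv a n m) n"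
proof -
  have step: "fps_nth (sfrac_conv a (Suc d) m) n = fps_nth (sfrac_conv a d m) n" if "n \<le> d" for n d m
    using that
  proof (induction d arbitrary: n m)
    case 0
    then show ?case by simp
  next
    case (Suc d)
    show ?case unfolding sfrac_conv.simps(2)[of a "Suc d" m] sfrac_conv.simps(2)[of a d m]
    proof (rule fps_inverse_nth_cong)
      fix i assume "i \<le> n"
      then show "fps_nth (1 - fps_const (a m) * fps_X * sfrac_conv a (Suc d) (Suc m)) i
          = fps_nth (1 - fps_const (a m) * fps_X * sfrac_conv a d (Suc m)) i"
        using Suc.IH[of "i - 1" "Suc m"] Suc.prems
        by (cases i) (simp_all add: mult.assoc del: sfrac_conv.simps)
    qed
  qed
  show "n \<le> d \<Longrightarrow> ?thesis"
    by (induction d rule: dec_induct) (simp_all add: step del: sfrac_conv.simps)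
qed

lemma sfrac_conv_tendsto: "(\<lambda>d. sfrac_conv a d 1) \<longlonglongrightarrow> sfrac a"
proof -
  have "(\<lambda>d. sfrac_conv a d 1) \<longlonglongrightarrow> Abs_fps (\<lambda>n. fps_nth (sfrac_conv a n 1) n)"
    unfolding tendsto_fps_iff
    by (auto intro!: eventually_mono[OF eventually_ge_at_top] sfrac_conv_stable)
  then show ?thesis unfolding sfrac_def using limI by metis
qed

definition tq_euler :: "nat \<Rightarrow> ratfun_tq" where
  "tq_euler n = fps_nth (sfrac (\<lambda>m. q_int q_ind m * tq_int t_ind q_ind m)) n"

text \<open>The binomial coefficient with the convention that it vanishes for negative lower index.\<close>

definition binom :: "nat \<Rightarrow> int \<Rightarrow> int" where
  "binom a b = (if b < 0 then 0 else int (a choose nat b))"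

function T_poly :: "nat \<Rightarrow> int poly poly" where
  "T_poly k = (if k = 0 then 1
     else T_poly (k - 1) + (1 + tpol) * (- qpol) ^ (k\<^sup>2)
       + (1 - tpol\<^sup>2) * (\<Sum>i = 1..k - 1. (- qpol) ^ (k\<^sup>2 - i\<^sup>2) * T_poly (i - 1)))"
  by pat_completeness auto
termination by (relation "measure id") auto

declare T_poly.simps [simp del]

lemma T_poly_unique:
  assumes "U 0 = 1"
    and "\<And>k. k \<ge> 1 \<Longrightarrow> U k = U (k - 1) + (1 + tpol) * (- qpol) ^ (k\<^sup>2)
           + (1 - tpol\<^sup>2) * (\<Sum>i = 1..k - 1. (- qpol) ^ (k\<^sup>2 - i\<^sup>2) * U (i - 1))"
  shows "U = T_poly"
proof
  fix k show "U k = T_poly k"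
  proof (induction k rule: less_induct)
    case (less k)
    show ?case
    proof (cases "k = 0")
      case True
      then show ?thesis using assms(1) by (simp add: T_poly.simps)
    next
      case False
      then have "(\<Sum>i = 1..k - 1. (- qpol) ^ (k\<^sup>2 - i\<^sup>2) * U (i - 1))
          = (\<Sum>i = 1..k - 1. (- qpol) ^ (k\<^sup>2 - i\<^sup>2) * T_poly (i - 1))"
        by (intro sum.cong) (auto simp: less)
      then show ?thesis
        using False assms(2)[of k] less[of "k - 1"] by (subst T_poly.simps) simp
    qed
  qed
qed

end

theory Submission
  imports Defs
begin

text \<open>
  Substituting \<open>x = u / (1 + u)\<^sup>2\<close> turns the ballot numbers into powers of \<open>u\<close>: if
  \<open>F(x)\<close> is the continued fraction with partial coefficients \<open>(1 - q\<^sup>m) (1 - t q\<^sup>m)\<close>, the theorem says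
  that \<open>F(x) = (1 + u) G(u)\<close>, where the coefficients of \<open>G\<close> are \<open>t\<^sup>k q\<^bsup>k(k+1)\<^esup> T\<^sub>k(1/t, 1/q)\<close>.
  The recurrence of \<open>T\<^sub>k\<close> amounts to
  \<open>(1 + tqu) G(u) = 1 - qu + q\<^sup>2u (t + qu) G(q\<^sup>2u)\<close>.
  On the other side, the products of the tails of the continued fraction become, after
  normalisation, series with \<open>K\<^sub>0 = 1\<close>, \<open>K\<^sub>1 = (1 - t) G\<close> and
  \<open>(1 + u) K\<^sub>m\<^sub>+\<^sub>1 = (1 - t q\<^sup>m) K\<^sub>m + (1 - q\<^bsup>m+1\<^esup>) u K\<^sub>m\<^sub>+\<^sub>2\<close>.
  This recurrence has only one solution as formal power series, and
  \<open>(1 + tqu) (K\<^sub>m\<^sub>+\<^sub>1(u) - K\<^sub>m(u)) = q\<^sup>m (t + qu) (q\<^sup>2u K\<^sub>m\<^sub>+\<^sub>1(q\<^sup>2u) - K\<^sub>m(q\<^sup>2u))\<close>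
  holds because the sequence defined by the right-hand side solves it as well; the case \<open>m = 0\<close>
  is the functional equation of \<open>G\<close>.
\<close>

unbundle fps_syntax

section \<open>Uniqueness for three-term recurrences of power series\<close>

text \<open>The factor \<open>fps_X\<close> makes coefficient \<open>n\<close> of term
  \<open>Suc m\<close> depend only on coefficient \<open>n\<close> of term \<open>m\<close> and on
  lower coefficients: hence induction on \<open>n\<close>, with an inner induction on
  \<open>m\<close>. Both \<open>c = 1\<close> and \<open>c = 0\<close> occur below.\<close>

lemma three_term_unique:
  fixes f g :: "nat \<Rightarrow> 'a::comm_ring_1 fps"
  assumes f: "\<And>m. f (Suc m) = fps_const (a m) * f m
                 + fps_X * (fps_const (b m) * f (Suc (Suc m)) - fps_const c * f (Suc m))"
    and g: "\<And>m. g (Suc m) = fps_const (a m) * g m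
                 + fps_X * (fps_const (b m) * g (Suc (Suc m)) - fps_const c * g (Suc m))"
    and zero: "f 0 = g 0"
  shows "f m = g m"
proof -
  have "f m $ n = g m $ n" for m n
  proof (induction n arbitrary: m)
    case 0
    show ?case
    proof (induction m)
      case (Suc m)
      then show ?case by (subst f, subst g) simp
    qed (simp add: zero)
  next
    case IH: (Suc n)
    show ?case
    proof (induction m)
      case (Suc m)
      then show ?case by (subst f, subst g) (simp add: IH)
    qed (simp add: zero)
  qed
  then show ?thesis by (simp add: fps_eq_iff)
qed

section \<open>The Chebyshev coefficient series\<close>

text \<open>
  Up to the factor \<open>(t;q)\<^sub>m\<close>, the number \<open>cheb_coeff t q m n\<close> is the coefficient of \<open>P\<^sub>m\<^sub>-\<^sub>1\<close>
  in the expansion of the Chebyshev polynomial \<open>U\<^sub>m\<^sub>-\<^sub>1\<^sub>+\<^sub>2\<^sub>n\<close>, where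
  \<open>P\<^sub>m\<^sub>+\<^sub>1 = X P\<^sub>m - (1 - q\<^sup>m) (1 - t q\<^sup>m) P\<^sub>m\<^sub>-\<^sub>1\<close>.
  The index is shifted so that the recurrence holds for every \<open>m\<close>, with constant initial series.
\<close>

fun cheb_coeff :: "'a::comm_ring_1 \<Rightarrow> 'a \<Rightarrow> nat \<Rightarrow> nat \<Rightarrow> 'a" where
  "cheb_coeff t q 0 n = (if n = 0 then 1 else 0)"
| "cheb_coeff t q (Suc m) 0 = (1 - t * q ^ m) * cheb_coeff t q m 0"
| "cheb_coeff t q (Suc m) (Suc n) = (1 - t * q ^ m) * cheb_coeff t q m (Suc n)
     + (1 - q ^ Suc m) * cheb_coeff t q (Suc (Suc m)) n - cheb_coeff t q (Suc m) n"

definition cheb_fps :: "'a::comm_ring_1 \<Rightarrow> 'a \<Rightarrow> nat \<Rightarrow> 'a fps" where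
  "cheb_fps t q m = Abs_fps (cheb_coeff t q m)"

lemma cheb_fps_nth [simp]: "cheb_fps t q m $ n = cheb_coeff t q m n"
  by (simp add: cheb_fps_def)

lemma cheb_fps_0 [simp]: "cheb_fps t q 0 = 1"
  by (simp add: fps_eq_iff)

lemma cheb_fps_Suc:
  "cheb_fps t q (Suc m) = fps_const (1 - t * q ^ m) * cheb_fps t q m
     + fps_X * (fps_const (1 - q ^ Suc m) * cheb_fps t q (Suc (Suc m)) - cheb_fps t q (Suc m))"
proof (rule fps_ext)
  fix n show "cheb_fps t q (Suc m) $ n = (fps_const (1 - t * q ^ m) * cheb_fps t q m
     + fps_X * (fps_const (1 - q ^ Suc m) * cheb_fps t q (Suc (Suc m)) - cheb_fps t q (Suc m))) $ n"
    by (cases n) simp_all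
qed

section \<open>Functional equation under dilation by \<open>q^2\<close>\<close>

abbreviation dilate :: "'a::comm_ring_1 \<Rightarrow> 'a fps \<Rightarrow> 'a fps" where
  "dilate q f \<equiv> f oo (fps_const (q\<^sup>2) * fps_X)"

lemma cheb_fps_dilate:
  fixes t q :: "'a::field"
  shows "dilate q (cheb_fps t q (Suc m)) = fps_const (1 - t * q ^ m) * dilate q (cheb_fps t q m)
     + fps_const (q\<^sup>2) * fps_X * (fps_const (1 - q ^ Suc m) * dilate q (cheb_fps t q (Suc (Suc m)))
         - dilate q (cheb_fps t q (Suc m)))"
  by (subst cheb_fps_Suc)
     (simp add: fps_compose_add_distrib fps_compose_sub_distrib fps_compose_mult_distrib)

text \<open>The increment is the one demanded by \<open>cheb_fps_functional\<close>, solved for the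
  difference of neighbouring terms.\<close>

primrec cheb_candidate :: "'a::field \<Rightarrow> 'a \<Rightarrow> nat \<Rightarrow> 'a fps" where
  "cheb_candidate t q 0 = 1"
| "cheb_candidate t q (Suc m) = cheb_candidate t q m
     + inverse (1 + fps_const (t * q) * fps_X) * fps_const (q ^ m) * (fps_const t + fps_const q * fps_X)
       * (fps_const (q\<^sup>2) * fps_X * dilate q (cheb_fps t q (Suc m)) - dilate q (cheb_fps t q m))"

text \<open>
  The defect \<open>M m\<close> of the candidate in the three-term recurrence satisfies \<open>M (Suc m) = Q * M m\<close>.
\<close>

lemma cheb_candidate_rec:
  fixes t q :: "'a::field"
  shows "cheb_candidate t q (Suc m) = fps_const (1 - t * q ^ m) * cheb_candidate t q m
     + fps_X * (fps_const (1 - q ^ Suc m) * cheb_candidate t q (Suc (Suc m)) - cheb_candidate t q (Suc m))"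
proof -
  define T where "T = fps_const t"
  define Q where "Q = fps_const q"
  define u :: "'a fps" where "u = fps_X"
  define e where "e = 1 + T * Q * u"
  define p where "p = T + Q * u"
  define f where "f = cheb_candidate t q"
  define k where "k m = dilate q (cheb_fps t q m)" for m
  note fold = T_def[symmetric] Q_def[symmetric] u_def[symmetric] f_def[symmetric]
  have cs: "fps_const (q ^ m) = Q ^ m" "fps_const (t * q ^ m) = T * Q ^ m"
      "fps_const (1 - q ^ m) = 1 - Q ^ m" "fps_const (1 - t * q ^ m) = 1 - T * Q ^ m"
      "fps_const (t * q) = T * Q" for m
    by (simp_all add: T_def Q_def fps_const_power flip: fps_const_sub fps_const_mult)
  have e0: "e $ 0 \<noteq> 0" by (simp add: e_def u_def)
  then have e_inv: "e * inverse e = 1" by (simp add: inverse_mult_eq_1')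
  from e0 have e_nz: "e \<noteq> 0" by force
  have step: "e * (f (Suc m) - f m) = Q ^ m * p * (Q\<^sup>2 * u * k (Suc m) - k m)" for m
  proof -
    have "f (Suc m) - f m = inverse e * (Q ^ m * p * (Q\<^sup>2 * u * k (Suc m) - k m))"
      unfolding f_def cheb_candidate.simps cs e_def p_def k_def T_def Q_def u_def
      by (simp add: mult.assoc fps_const_power)
    then show ?thesis using e_inv by (metis mult.assoc mult.left_neutral)
  qed
  have krec: "k (Suc m) = (1 - T * Q ^ m) * k m
      + Q\<^sup>2 * u * ((1 - Q ^ Suc m) * k (Suc (Suc m)) - k (Suc m))" for m
    using cheb_fps_dilate[of t q m] unfolding k_def u_def cs Q_def by (simp add: fps_const_power)
  have k0: "k 0 = 1" "f 0 = 1" by (simp_all add: k_def f_def)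
  define M where "M m = (1 + u) * f (Suc m) - (1 - T * Q ^ m) * f m - (1 - Q ^ Suc m) * u * f (Suc (Suc m))" for m
  have "M m = 0"
  proof (induction m)
    case 0
    have K2: "(1 - Q) * (Q\<^sup>2 * u * k (Suc (Suc 0))) = (1 + Q\<^sup>2 * u) * k (Suc 0) - (1 - T)"
      using krec[of 0] k0 by (simp add: algebra_simps)
    \<comment> \<open>The coefficients of \<open>M m\<close> sum to \<open>Q ^ m * p\<close>. As
      \<open>f 0 = 1\<close>, the part of \<open>e * M 0\<close> not expressed by differences of
      \<open>f\<close> is \<open>e * p\<close>.\<close>
    have "e * M 0 = (1 + Q * u) * (e * (f (Suc 0) - f 0))
        - (1 - Q) * u * (e * (f (Suc (Suc 0)) - f (Suc 0))) + e * p"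
      by (simp add: M_def p_def k0 algebra_simps)
    also have "\<dots> = p * ((1 + Q * u) * (Q\<^sup>2 * u * k (Suc 0) - 1)
        - Q * u * ((1 - Q) * (Q\<^sup>2 * u * k (Suc (Suc 0))) - (1 - Q) * k (Suc 0)) + e)"
      unfolding step by (simp add: k0 algebra_simps)
    also have "\<dots> = 0"
      unfolding K2 by (simp add: e_def algebra_simps power2_eq_square)
    finally have "e * M 0 = 0" .
    with e_nz show ?case by simp
  next
    case (Suc m)
    let ?z = "Q ^ m" and ?w = "Q\<^sup>2 * u"
    \<comment> \<open>\<open>krec\<close> at \<open>m\<close> and \<open>Suc m\<close> eliminates
      the two outer terms of \<open>k\<close>, leaving the two middle ones.\<close>
    have K0: "(1 - T * ?z) * k m = (1 + ?w) * k (Suc m) - (1 - Q * ?z) * ?w * k (Suc (Suc m))"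
      using krec[of m] by (simp add: algebra_simps)
    have K3: "(1 - Q\<^sup>2 * ?z) * (?w * k (Suc (Suc (Suc m))))
        = (1 + ?w) * k (Suc (Suc m)) - (1 - T * Q * ?z) * k (Suc m)"
      using krec[of "Suc m"] by (simp add: algebra_simps power2_eq_square)
    \<comment> \<open>Here the coefficients sum to zero, so only differences of \<open>f\<close>
      remain, and \<open>step\<close> turns them into \<open>k\<close>.\<close>
    have "e * (M (Suc m) - Q * M m) = (1 + Q * u) * (e * (f (Suc (Suc m)) - f (Suc m)))
        - Q * (1 - T * ?z) * (e * (f (Suc m) - f m))
        - (1 - Q\<^sup>2 * ?z) * u * (e * (f (Suc (Suc (Suc m))) - f (Suc (Suc m))))"
      by (simp add: M_def algebra_simps power2_eq_square)
    also have "\<dots> = Q * ?z * p * ((1 + Q * u) * (?w * k (Suc (Suc m)) - k (Suc m))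
        - (1 - T * ?z) * ?w * k (Suc m) + (1 - T * ?z) * k m
        - Q * u * ((1 - Q\<^sup>2 * ?z) * (?w * k (Suc (Suc (Suc m)))) - (1 - Q\<^sup>2 * ?z) * k (Suc (Suc m))))"
      unfolding step by (simp add: algebra_simps power2_eq_square)
    also have "\<dots> = 0"
      unfolding K0 K3 by (simp add: algebra_simps power2_eq_square)
    finally have "e * (M (Suc m) - Q * M m) = 0" .
    with e_nz Suc show ?case by simp
  qed
  then show ?thesis
    unfolding M_def fold cs by (simp add: algebra_simps)
qed

text \<open>\<open>cheb_candidate\<close> solves the recurrence of \<open>cheb_fps\<close> with the
  same initial term, so uniqueness identifies the two.\<close>

lemma cheb_fps_functional:
  fixes t q :: "'a::field"
  shows "(1 + fps_const (t * q) * fps_X) * (cheb_fps t q (Suc m) - cheb_fps t q m)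
     = fps_const (q ^ m) * (fps_const t + fps_const q * fps_X)
       * (fps_const (q\<^sup>2) * fps_X * dilate q (cheb_fps t q (Suc m)) - dilate q (cheb_fps t q m))"
proof -
  have eq: "cheb_fps t q m = cheb_candidate t q m" for m
  proof (rule three_term_unique)
    show "cheb_fps t q (Suc m) = fps_const (1 - t * q ^ m) * cheb_fps t q m
        + fps_X * (fps_const (1 - q ^ Suc m) * cheb_fps t q (Suc (Suc m)) - fps_const 1 * cheb_fps t q (Suc m))" for m
      using cheb_fps_Suc[of t q m] by simp
    show "cheb_candidate t q (Suc m) = fps_const (1 - t * q ^ m) * cheb_candidate t q m
        + fps_X * (fps_const (1 - q ^ Suc m) * cheb_candidate t q (Suc (Suc m)) - fps_const 1 * cheb_candidate t q (Suc m))" for m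
      using cheb_candidate_rec[of t q m] by simp
  qed simp
  define e where "e = 1 + fps_const (t * q) * fps_X"
  have "e * inverse e = 1"
    by (rule inverse_mult_eq_1') (simp add: e_def)
  moreover have "cheb_candidate t q (Suc m) - cheb_candidate t q m = inverse e
      * (fps_const (q ^ m) * (fps_const t + fps_const q * fps_X)
       * (fps_const (q\<^sup>2) * fps_X * dilate q (cheb_fps t q (Suc m)) - dilate q (cheb_fps t q m)))"
    by (simp only: cheb_candidate.simps e_def mult.assoc add_diff_cancel_left')
  ultimately show ?thesis
    unfolding e_def[symmetric] eq[symmetric] by (metis mult.assoc mult.left_neutral)
qed

text \<open>Coefficient comparison in the functional equation at \<open>m = 0\<close>; dilation
  multiplies coefficient \<open>n\<close> by \<open>q ^ (2 * n)\<close>.\<close>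

lemma cheb_coeff_1_rec:
  fixes t q :: "'a::field"
  shows "cheb_coeff t q 1 0 = 1 - t"
    "cheb_coeff t q 1 1 = (1 - t) * (t * q\<^sup>2 - t * q - q)"
    "cheb_coeff t q 1 (Suc (Suc n)) + t * q * cheb_coeff t q 1 (Suc n)
      = t * q ^ (2 * n + 4) * cheb_coeff t q 1 (Suc n) + q ^ (2 * n + 3) * cheb_coeff t q 1 n"
proof -
  define F where "F = cheb_fps t q 1"
  define G where "G = dilate q F"
  have F: "F + fps_X * (fps_const (t * q) * F) = 1 + fps_X * fps_const (t * q) - fps_const t - fps_X * fps_const q
    + fps_X * (fps_const (t * q\<^sup>2) * G) + fps_X * (fps_X * (fps_const (q ^ 3) * G))"
    using cheb_fps_functional[of t q 0] unfolding F_def G_def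
    by (simp add: algebra_simps power2_eq_square power3_eq_cube flip: fps_const_mult)
  have F_nth: "F $ n = cheb_coeff t q 1 n" for n
    by (simp add: F_def)
  have G_nth: "G $ n = q ^ (2 * n) * cheb_coeff t q 1 n" for n
    by (simp add: G_def fps_compose_linear F_def power_mult)
  note coeff = arg_cong[OF F, of "\<lambda>h. h $ n" for n]
  show zero: "cheb_coeff t q 1 0 = 1 - t" by simp
  show "cheb_coeff t q 1 1 = (1 - t) * (t * q\<^sup>2 - t * q - q)"
    using coeff[of 1] unfolding fps_add_nth fps_sub_nth
    by (simp add: F_nth G_nth zero del: cheb_coeff.simps) (simp add: algebra_simps)
  show "cheb_coeff t q 1 (Suc (Suc n)) + t * q * cheb_coeff t q 1 (Suc n)
      = t * q ^ (2 * n + 4) * cheb_coeff t q 1 (Suc n) + q ^ (2 * n + 3) * cheb_coeff t q 1 n"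
    using coeff[of "Suc (Suc n)"]
    by (simp add: F_nth G_nth del: cheb_coeff.simps) (simp add: algebra_simps eval_nat_numeral del: cheb_coeff.simps)
qed

section \<open>Ballot numbers\<close>

primrec ballot :: "nat \<Rightarrow> nat \<Rightarrow> int" where
  "ballot N 0 = 1"
| "ballot N (Suc i) = int (N choose Suc i) - int (N choose i)"

lemma ballot_Suc_Suc: "ballot (Suc N) (Suc i) = ballot N (Suc i) + ballot N i"
  by (cases i) simp_all

text \<open>Symmetry of an odd row of Pascal's triangle. This kills the higher coefficients of
  \<open>W 0\<close> below.\<close>

lemma ballot_middle: "ballot (2 * j + 1) (Suc j) = 0"
  using binomial_symmetric[of j "2 * j + 1"] by simp

lemma binom_diff_eq_ballot:
  assumes "k \<le> n"
  shows "binom N (int n - int k) - binom N (int n - int k - 1) = ballot N (n - k)"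
proof -
  obtain j where n: "n = k + j" using assms le_Suc_ex by blast
  show ?thesis unfolding n by (cases j) (simp_all add: binom_def nat_add_distrib)
qed

section \<open>Tails of the continued fraction and the ballot sum\<close>

text \<open>The infinite fraction starting at \<open>a m\<close>: coefficient \<open>n\<close> is
  already final at depth \<open>n\<close>.\<close>

definition sfrac_tail :: "(nat \<Rightarrow> 'a::field) \<Rightarrow> nat \<Rightarrow> 'a fps" where
  "sfrac_tail a m = Abs_fps (\<lambda>n. sfrac_conv a n m $ n)"

lemma sfrac_eq_tail: "sfrac a = sfrac_tail a 1"
proof -
  have "(\<lambda>d. sfrac_conv a d 1) \<longlonglongrightarrow> sfrac_tail a 1"
    unfolding tendsto_fps_iff sfrac_tail_def
    by (auto intro!: eventually_mono[OF eventually_ge_at_top] sfrac_conv_stable)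
  then show ?thesis using sfrac_conv_tendsto LIMSEQ_unique by blast
qed

lemma sfrac_tail_unfold:
  "sfrac_tail a m = 1 + fps_const (a m) * fps_X * (sfrac_tail a m * sfrac_tail a (Suc m))"
proof -
  define h where "h = 1 - fps_const (a m) * fps_X * sfrac_tail a (Suc m)"
  have "sfrac_tail a m = inverse h"
  proof (rule fps_ext)
    fix n
    have "sfrac_tail a m $ n = sfrac_conv a (Suc n) m $ n"
      unfolding sfrac_tail_def fps_nth_Abs_fps by (rule sfrac_conv_stable[symmetric]) simp
    also have "\<dots> = inverse h $ n"
      unfolding sfrac_conv.simps
    proof (rule fps_inverse_nth_cong)
      fix i assume "i \<le> n"
      then show "(1 - fps_const (a m) * fps_X * sfrac_conv a n (Suc m)) $ i = h $ i"
        using sfrac_conv_stable[of "i - 1" n a "Suc m"]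
        by (cases i) (simp_all add: h_def sfrac_tail_def mult.assoc)
    qed
    finally show "sfrac_tail a m $ n = inverse h $ n" .
  qed
  moreover have "inverse h * h = 1" by (rule inverse_mult_eq_1) (simp add: h_def)
  ultimately have "sfrac_tail a m * h = 1" by simp
  then show ?thesis by (simp add: h_def algebra_simps)
qed

text \<open>The two sides are the coefficients of \<open>V 1\<close> and \<open>W 1\<close>, where
  \<open>V\<close> and \<open>W\<close> solve the same three-term recurrence with initial term
  1.\<close>

lemma sfrac_tq_eq_ballot_sum:
  fixes t q :: "'a::field"
  shows "(1 - t) * sfrac (\<lambda>m. q_int q m * tq_int t q m) $ n
    = (1 / (1 - q)) ^ (2 * n) * (\<Sum>k\<le>n. of_int (ballot (2 * n) (n - k)) * cheb_coeff t q 1 k)"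
proof -
  define c where "c = 1 / (1 - q)"
  define S where "S = sfrac_tail (\<lambda>m. q_int q m * tq_int t q m)"
  \<comment> \<open>The factor \<open>(t;q)_m\<close> absorbs \<open>1 - t * q ^ m\<close> from the
    partial coefficients and makes the recurrence fit \<open>three_term_unique\<close>.\<close>
  define V where "V m = fps_const (\<Prod>i<m. 1 - t * q ^ i) * (\<Prod>i<m. S (Suc i))" for m
  \<comment> \<open>For \<open>m = n = 0\<close> the truncated \<open>m + 2 * n - 1\<close> is harmless, since \<open>ballot N 0 = 1\<close> for all \<open>N\<close>.\<close>
  define W where "W m = Abs_fps (\<lambda>n. c ^ (2 * n)
      * (\<Sum>k\<le>n. of_int (ballot (m + 2 * n - 1) (n - k)) * cheb_coeff t q m k))" for m
  have "V 1 = W 1"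
  proof (rule three_term_unique)
    fix m
    define P where "P = fps_const (1 - t * q ^ m)"
    define R where "R = fps_const (1 - t * q ^ Suc m)"
    define L where "L = fps_const (c\<^sup>2 * (1 - q ^ Suc m))"
    have V1: "V (Suc m) = P * V m * S (Suc m)"
      and V2: "V (Suc (Suc m)) = P * R * V m * S (Suc m) * S (Suc (Suc m))"
      unfolding V_def prod.lessThan_Suc fps_const_mult[symmetric] P_def R_def by (simp_all only: mult_ac)
    have "q_int q (Suc m) * tq_int t q (Suc m) = (c\<^sup>2 * (1 - q ^ Suc m)) * (1 - t * q ^ Suc m)"
      by (simp add: q_int_def tq_int_def c_def power2_eq_square)
    then have S1: "S (Suc m) = 1 + L * R * fps_X * (S (Suc m) * S (Suc (Suc m)))"
      unfolding S_def L_def R_def fps_const_mult by (subst sfrac_tail_unfold) simp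
    have "P * V m * S (Suc m) = P * V m + fps_X * (L * (P * R * V m * S (Suc m) * S (Suc (Suc m))))"
      by (subst S1) (simp add: algebra_simps)
    then show "V (Suc m) = fps_const (1 - t * q ^ m) * V m
        + fps_X * (fps_const (c\<^sup>2 * (1 - q ^ Suc m)) * V (Suc (Suc m)) - fps_const 0 * V (Suc m))"
      unfolding V1 V2 P_def[symmetric] L_def[symmetric] by simp
  next
    fix m
    show "W (Suc m) = fps_const (1 - t * q ^ m) * W m
        + fps_X * (fps_const (c\<^sup>2 * (1 - q ^ Suc m)) * W (Suc (Suc m)) - fps_const 0 * W (Suc m))"
    proof (rule fps_ext)
      fix n
      show "W (Suc m) $ n = (fps_const (1 - t * q ^ m) * W m + fps_X
          * (fps_const (c\<^sup>2 * (1 - q ^ Suc m)) * W (Suc (Suc m)) - fps_const 0 * W (Suc m))) $ n"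
      proof (cases n)
        case 0
        then show ?thesis by (simp add: W_def)
      next
        case (Suc j)
        \<comment> \<open>The row \<open>m + 2 * n - 1\<close> is \<open>N\<close> for
          \<open>W m\<close> at \<open>Suc j\<close> and for \<open>W (Suc (Suc m))\<close> at
          \<open>j\<close>, but \<open>Suc N\<close> for \<open>W (Suc m)\<close> at
          \<open>Suc j\<close>.\<close>
        define N where "N = Suc (m + 2 * j)"
        define b where "b N i = (of_int (ballot N i) :: 'a)" for N i
        define K where "K = cheb_coeff t q"
        have pascal: "b (Suc N) (Suc i) = b N (Suc i) + b N i" for i
          by (simp add: b_def ballot_Suc_Suc del: ballot.simps)
        have b0: "b M 0 = 1" for M by (simp add: b_def)
        have K: "(1 - t * q ^ m) * K m 0 = K (Suc m) 0"
          "(1 - t * q ^ m) * K m (Suc k) = K (Suc m) (Suc k) + K (Suc m) k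
             - (1 - q ^ Suc m) * K (Suc (Suc m)) k" for k
          by (simp_all add: K_def)
        have "(\<Sum>k\<le>Suc j. b (Suc N) (Suc j - k) * K (Suc m) k)
            = (\<Sum>k\<le>Suc j. b N (Suc j - k) * K (Suc m) k) + (\<Sum>k\<le>j. b N (j - k) * K (Suc m) k)"
          by (simp add: Suc_diff_le pascal b0 sum.distrib algebra_simps)
        also have "(\<Sum>k\<le>Suc j. b N (Suc j - k) * K (Suc m) k)
            = b N (Suc j) * ((1 - t * q ^ m) * K m 0) + (\<Sum>k\<le>j. b N (j - k) * K (Suc m) (Suc k))"
          by (subst sum.atMost_Suc_shift) (simp add: K)
        \<comment> \<open>The second sum from Pascal's rule cancels the term
          \<open>- K (Suc m) k\<close> of the Chebyshev recurrence; hence \<open>c = 0\<close> for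
          \<open>W\<close>.\<close>
        also have "\<dots> + (\<Sum>k\<le>j. b N (j - k) * K (Suc m) k)
            = b N (Suc j) * ((1 - t * q ^ m) * K m 0)
              + (\<Sum>k\<le>j. b N (j - k) * ((1 - t * q ^ m) * K m (Suc k)
                   + (1 - q ^ Suc m) * K (Suc (Suc m)) k))"
          by (simp only: K(2) sum.distrib distrib_left add.assoc diff_add_cancel)
        also have "\<dots> = (1 - t * q ^ m) * (\<Sum>k\<le>Suc j. b N (Suc j - k) * K m k)
              + (1 - q ^ Suc m) * (\<Sum>k\<le>j. b N (j - k) * K (Suc (Suc m)) k)"
          unfolding sum.atMost_Suc_shift[of "\<lambda>k. b N (Suc j - k) * K m k"]
          by (simp add: sum.distrib sum_distrib_left distrib_left mult.left_commute add.assoc del: cheb_coeff.simps)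
        finally have *: "(\<Sum>k\<le>Suc j. b (Suc N) (Suc j - k) * K (Suc m) k)
            = (1 - t * q ^ m) * (\<Sum>k\<le>Suc j. b N (Suc j - k) * K m k)
              + (1 - q ^ Suc m) * (\<Sum>k\<le>j. b N (j - k) * K (Suc (Suc m)) k)" .
        have W: "W (Suc m) $ Suc j = c ^ (2 * Suc j) * (\<Sum>k\<le>Suc j. b (Suc N) (Suc j - k) * K (Suc m) k)"
          "W m $ Suc j = c ^ (2 * Suc j) * (\<Sum>k\<le>Suc j. b N (Suc j - k) * K m k)"
          "W (Suc (Suc m)) $ j = c ^ (2 * j) * (\<Sum>k\<le>j. b N (j - k) * K (Suc (Suc m)) k)"
          by (simp_all only: W_def fps_nth_Abs_fps b_def K_def N_def) (simp_all only: add_Suc add_Suc_right mult_2 diff_Suc_1)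
        have "W (Suc m) $ Suc j = (1 - t * q ^ m) * W m $ Suc j
            + c\<^sup>2 * (1 - q ^ Suc m) * W (Suc (Suc m)) $ j"
          unfolding W * by (simp add: algebra_simps power2_eq_square)
        then show ?thesis unfolding Suc by simp
      qed
    qed
  next
    show "V 0 = W 0"
    proof (rule fps_ext)
      fix n
      show "V 0 $ n = W 0 $ n"
      proof (cases n)
        case 0
        then show ?thesis by (simp add: V_def W_def)
      next
        case (Suc j)
        have "(\<Sum>k\<le>n. of_int (ballot (2 * n - 1) (n - k)) * cheb_coeff t q 0 k)
            = (of_int (ballot (2 * n - 1) n) :: 'a)"
          by (simp add: if_distrib[of "\<lambda>x. _ * x"] sum.delta cong: if_cong)
        also have "\<dots> = 0" unfolding Suc using ballot_middle[of j] by (simp del: ballot.simps)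
        finally show ?thesis using Suc by (simp add: V_def W_def)
      qed
    qed
  qed
  then have "V 1 $ n = W 1 $ n" by simp
  then show ?thesis
    by (simp add: V_def W_def S_def c_def sfrac_eq_tail del: cheb_coeff.simps)
qed

section \<open>The polynomials \<open>T_poly\<close> and their substitution\<close>

text \<open>As \<open>(k+2)^2 - (k+1)^2 = 2k+3\<close>, the increment of \<open>T_poly\<close> at
  \<open>k+2\<close> is \<open>(-q)^(2k+3)\<close> times the one at \<open>k+1\<close> plus
  \<open>(1 - t^2) T_k\<close>.\<close>

lemma T_poly_rec:
  "T_poly 0 = 1"
  "T_poly 1 = 1 - (1 + tpol) * qpol"
  "T_poly (Suc (Suc k)) = T_poly (Suc k) - qpol ^ (2 * k + 3) * (T_poly (Suc k) - tpol\<^sup>2 * T_poly k)"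
proof -
  show zero: "T_poly 0 = 1" by (simp add: T_poly.simps)
  show "T_poly 1 = 1 - (1 + tpol) * qpol" by (simp add: T_poly.simps[of "Suc 0"] zero algebra_simps)
  have sq: "(Suc (Suc k))\<^sup>2 = 2 * k + 3 + (Suc k)\<^sup>2" by (simp add: power2_eq_square)
  have odd: "(- qpol) ^ (2 * k + 3) = - (qpol ^ (2 * k + 3))" by (simp add: power_minus_odd)
  define s where "s = (\<Sum>i = 1..k. (- qpol) ^ ((Suc k)\<^sup>2 - i\<^sup>2) * T_poly (i - 1))"
  have "(- qpol) ^ ((Suc (Suc k))\<^sup>2 - i\<^sup>2) * T_poly (i - 1)
      = (- qpol) ^ (2 * k + 3) * ((- qpol) ^ ((Suc k)\<^sup>2 - i\<^sup>2) * T_poly (i - 1))"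
    if "i \<in> {1..k}" for i
  proof -
    have "i\<^sup>2 \<le> (Suc k)\<^sup>2" using that by (intro power_mono) auto
    then have "(Suc (Suc k))\<^sup>2 - i\<^sup>2 = (2 * k + 3) + ((Suc k)\<^sup>2 - i\<^sup>2)" using sq by simp
    then show ?thesis by (simp only: power_add mult.assoc)
  qed
  then have "(\<Sum>i = 1..k. (- qpol) ^ ((Suc (Suc k))\<^sup>2 - i\<^sup>2) * T_poly (i - 1)) = (- qpol) ^ (2 * k + 3) * s"
    unfolding s_def sum_distrib_left by (intro sum.cong) auto
  moreover have "(Suc (Suc k))\<^sup>2 - (Suc k)\<^sup>2 = 2 * k + 3" using sq by simp
  ultimately have "(\<Sum>i = 1..Suc k. (- qpol) ^ ((Suc (Suc k))\<^sup>2 - i\<^sup>2) * T_poly (i - 1))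
      = (- qpol) ^ (2 * k + 3) * (s + T_poly k)"
    by (simp add: distrib_left)
  moreover define z where "z = (- qpol) ^ (2 * k + 3)"
  moreover have "(- qpol) ^ ((Suc (Suc k))\<^sup>2) = z * (- qpol) ^ ((Suc k)\<^sup>2)"
    unfolding z_def sq by (rule power_add)
  ultimately have "T_poly (Suc (Suc k)) = T_poly (Suc k) + (1 + tpol) * (z * (- qpol) ^ ((Suc k)\<^sup>2))
      + (1 - tpol\<^sup>2) * (z * (s + T_poly k))"
    by (subst T_poly.simps) simp
  also have "\<dots> = T_poly (Suc k)
      + z * ((1 + tpol) * (- qpol) ^ ((Suc k)\<^sup>2) + (1 - tpol\<^sup>2) * (s + T_poly k))"
    by (simp add: distrib_left mult.left_commute)
  also have "(1 + tpol) * (- qpol) ^ ((Suc k)\<^sup>2) + (1 - tpol\<^sup>2) * (s + T_poly k)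
      = T_poly (Suc k) - tpol\<^sup>2 * T_poly k"
    by (simp add: T_poly.simps[of "Suc k"] s_def algebra_simps)
  finally show "T_poly (Suc (Suc k)) = T_poly (Suc k) - qpol ^ (2 * k + 3) * (T_poly (Suc k) - tpol\<^sup>2 * T_poly k)"
    unfolding z_def odd by simp
qed

lemma map_poly_ring_hom:
  fixes f :: "'a::comm_ring_1 \<Rightarrow> 'b::comm_ring_1"
  assumes "f 0 = 0" "\<And>x y. f (x + y) = f x + f y" "\<And>x y. f (x * y) = f x * f y"
  shows "map_poly f (p + r) = map_poly f p + map_poly f r"
    "map_poly f (p * r) = map_poly f p * map_poly f r"
proof -
  have "f (sum g A) = (\<Sum>i\<in>A. f (g i))" for g :: "nat \<Rightarrow> 'a" and A
    by (induction A rule: infinite_finite_induct) (simp_all add: assms)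
  then show "map_poly f (p + r) = map_poly f p + map_poly f r"
    "map_poly f (p * r) = map_poly f p * map_poly f r"
    by (simp_all add: poly_eq_iff coeff_map_poly coeff_mult assms)
qed

context
  fixes a b :: "'a::comm_ring_1"
begin

lemma subst_tq_add: "subst_tq (P + Q) a b = subst_tq P a b + subst_tq Q a b"
  and subst_tq_mult: "subst_tq (P * Q) a b = subst_tq P a b * subst_tq Q a b"
  unfolding subst_tq_def by (simp_all add: map_poly_ring_hom)

lemma subst_tq_1: "subst_tq 1 a b = 1"
  and subst_tq_tpol: "subst_tq tpol a b = a"
  and subst_tq_qpol: "subst_tq qpol a b = b"
  by (simp_all add: subst_tq_def tpol_def qpol_def map_poly_pCons map_poly_1)

lemma subst_tq_diff: "subst_tq (P - Q) a b = subst_tq P a b - subst_tq Q a b"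
  using subst_tq_add[of "P - Q" Q] by simp

lemma subst_tq_power: "subst_tq (P ^ k) a b = subst_tq P a b ^ k"
  by (induction k) (simp_all add: subst_tq_1 subst_tq_mult)

lemmas subst_tq_simps = subst_tq_add subst_tq_diff subst_tq_mult subst_tq_power
  subst_tq_1 subst_tq_tpol subst_tq_qpol

end

text \<open>Both sides obey the same second-order recurrence in \<open>k\<close>, with equal values
  at 0 and 1.\<close>

lemma cheb_coeff_1_eq_T_poly:
  fixes t q :: "'a::field"
  assumes "t \<noteq> 0" "q \<noteq> 0"
  shows "cheb_coeff t q 1 k
    = (1 - t) * (t ^ k * q ^ (k * (k + 1)) * subst_tq (T_poly k) (inverse t) (inverse q))"
proof (induction k rule: induct_nat_012)
  case 0
  show ?case by (simp add: T_poly_rec subst_tq_simps)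
next
  case 1
  show ?case
    unfolding One_nat_def[symmetric] cheb_coeff_1_rec T_poly_rec subst_tq_simps
    using assms by (simp add: field_simps power2_eq_square)
next
  case (ge2 k)
  define y0 where "y0 = subst_tq (T_poly k) (inverse t) (inverse q)"
  define y1 where "y1 = subst_tq (T_poly (Suc k)) (inverse t) (inverse q)"
  \<comment> \<open>With \<open>z\<close> and \<open>w\<close> below, the prefactors at
    \<open>k\<close>, \<open>k+1\<close>, \<open>k+2\<close> are \<open>A\<close>,
    \<open>t * w * A\<close> and \<open>t^2 * q * z * w * A\<close>.\<close>
  define A where "A = t ^ k * q ^ (k * (k + 1))"
  have y2: "subst_tq (T_poly (Suc (Suc k))) (inverse t) (inverse q)
      = y1 - inverse q ^ (2 * k + 3) * (y1 - (inverse t)\<^sup>2 * y0)"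
    unfolding T_poly_rec subst_tq_simps y0_def y1_def ..
  define z where "z = q ^ (2 * k + 3)"
  have z: "z \<noteq> 0" "inverse q ^ (2 * k + 3) = inverse z" using assms by (simp_all add: z_def power_inverse)
  define w where "w = q ^ (2 * k + 2)"
  have zw: "z = q * w" "q ^ (2 * k + 4) = q * z"
    by (simp_all add: z_def w_def eval_nat_numeral)
  have "Suc k * (Suc k + 1) = (2 * k + 2) + k * (k + 1)" by simp
  then have A1: "t ^ Suc k * q ^ (Suc k * (Suc k + 1)) = t * w * A"
    unfolding A_def w_def by (simp only: power_add power_Suc mult_ac)
  have "Suc (Suc k) * (Suc (Suc k) + 1) = (2 * k + 4) + ((2 * k + 2) + k * (k + 1))" by simp
  then have "q ^ (Suc (Suc k) * (Suc (Suc k) + 1)) = (q * z) * (w * q ^ (k * (k + 1)))"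
    by (simp only: power_add[of q "2 * k + 4"] power_add[of q "2 * k + 2"] zw(2) w_def)
  then have A2: "t ^ Suc (Suc k) * q ^ (Suc (Suc k) * (Suc (Suc k) + 1)) = t\<^sup>2 * q * z * w * A"
    unfolding A_def power2_eq_square by (simp only: power_Suc mult_ac)
  have IH: "cheb_coeff t q 1 k = (1 - t) * (A * y0)"
    "cheb_coeff t q 1 (Suc k) = (1 - t) * (t * w * A * y1)"
    using ge2 unfolding A1 A_def y0_def y1_def by (simp_all only:)
  have "cheb_coeff t q 1 (Suc (Suc k))
      = t * q * z * ((1 - t) * (t * w * A * y1)) + z * ((1 - t) * (A * y0)) - t * q * ((1 - t) * (t * w * A * y1))"
    using cheb_coeff_1_rec(3)[of t q k] unfolding IH zw(2) z_def[symmetric]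
    by (simp add: algebra_simps del: cheb_coeff.simps)
  also have "\<dots> = (1 - t) * (t\<^sup>2 * q * z * w * A * (y1 - inverse z * (y1 - (inverse t)\<^sup>2 * y0)))"
  proof -
    have "t\<^sup>2 * q * z * w * A * (y1 - inverse z * (y1 - (inverse t)\<^sup>2 * y0))
        = t\<^sup>2 * q * z * w * A * y1 - (z * inverse z) * (q * w) * (A * (t\<^sup>2 * y1 - (t * inverse t)\<^sup>2 * y0))"
      by (simp only: algebra_simps power_mult_distrib)
    also have "\<dots> = t\<^sup>2 * q * z * w * A * y1 - t\<^sup>2 * q * w * A * y1 + z * A * y0"
      using z assms by (simp add: zw(1)[symmetric] algebra_simps)
    finally show ?thesis
      by (simp only:) (simp add: algebra_simps power2_eq_square)
  qed
  finally show ?case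
    unfolding A2 y2 z(2) .
qed

section \<open>Specialisation to the indeterminates\<close>

lemma q_t_ind_generic: "t_ind \<noteq> 0" "q_ind \<noteq> 0" "1 - t_ind \<noteq> 0"
  by (simp_all add: t_ind_def q_ind_def tpol_def qpol_def Zero_fract_def One_fract_def eq_fract one_pCons)

theorem theorem1p1:
  fixes n :: nat
  shows "tq_euler n =
    1 / (1 - q_ind) ^ (2 * n) *
      (\<Sum>k = 0..n.
         of_int (binom (2 * n) (int n - int k) - binom (2 * n) (int n - int k - 1))
           * t_ind ^ k * q_ind ^ (k * (k + 1))
           * subst_tq (T_poly k) (inverse t_ind) (inverse q_ind))"
    (is "_ = _ * ?R")
proof -
  have "?R = (\<Sum>k\<le>n. of_int (ballot (2 * n) (n - k))
      * (t_ind ^ k * q_ind ^ (k * (k + 1)) * subst_tq (T_poly k) (inverse t_ind) (inverse q_ind)))"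
    unfolding atMost_atLeast0 by (intro sum.cong) (simp_all add: binom_diff_eq_ballot mult.assoc)
  then have "(1 - t_ind) * ?R
      = (\<Sum>k\<le>n. of_int (ballot (2 * n) (n - k)) * cheb_coeff t_ind q_ind 1 k)"
    unfolding cheb_coeff_1_eq_T_poly[OF q_t_ind_generic(1,2)] by (simp only: sum_distrib_left mult_ac)
  then have "(1 - t_ind) * tq_euler n = (1 - t_ind) * (1 / (1 - q_ind) ^ (2 * n) * ?R)"
    unfolding tq_euler_def sfrac_tq_eq_ballot_sum by (simp add: power_one_over mult_ac)
  then show ?thesis using q_t_ind_generic(3) mult_left_cancel by blast
qed

end
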